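(* If $\Gamma\vdash t:A$ and $\phi$ is a $\Gamma$-valuation, then $[\![t]\!]_\phi\subseteq[\![A]\!]$.
   Context: Setting: a first-order quantum lambda-calculus with qubit types $\Psi ::= B \mid S(\Psi)\mid \Psi\otimes\Psi$ (base qubit types $B::=\mathbb{B}\mid B\otimes B$), types $A::=\Psi\mid \Psi\Rightarrow A\mid S(A)\mid A\otimes A$, and terms built from variables, abstractions $\lambda x:\Psi~t$, application, $|0\rangle,|1\rangle$, sums $t+u$, scalar products $\alpha.t$ ($\alpha\in\mathbb C$), null vectors $\vec 0$, an if-then-else constant, measurement $\pi_j$, tensor $t\otimes u$, $\mathit{head}$, $\mathit{tail}$ and casts $\Uparrow^{B\otimes C}_A t$, typed by a type system with subtyping ($A\preceq S(A)$, $S(S(A))\preceq S(A)$, closed under $\Psi\Rightarrow\cdot$, $S(\cdot)$ and both sides of $\otimes$). Types are interpreted as subsets of vector spaces: $[\![\mathbb{B}]\!]=\{(1,0)^T,(0,1)^T\}\subseteq\mathbb C^2$, $[\![S(A)]\!]$ is the linear span of $[\![A]\!]$, $[\![\Psi\Rightarrow A]\!]$ is the set of functions from $[\![\Psi]\!]$ to $[\![A]\!]$, and $[\![A\otimes B]\!]=\{u\otimes v\mid u\in[\![A]\!],v\in[\![B]\!]\}$. If $\Gamma=x_1:\Psi_1,\dots,x_n:\Psi_n$, a $\Gamma$-valuation maps each $x_i$ to $[\![\Psi_i]\!]$. Each term $t$ is interpreted as a set $[\![t]\!]_\phi$ of elements (a set because measurement is probabilistic), e.g. $[\![x]\!]_\phi=\phi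 x$, $[\![|0\rangle]\!]_\phi=\{(1,0)^T\}$, $[\![t+u]\!]_\phi=\{a+b\mid a\in[\![t]\!]_\phi,b\in[\![u]\!]_\phi\}$, $[\![\alpha.t]\!]_\phi=\{\alpha a\mid a\in[\![t]\!]_\phi\}$, $[\![t\otimes u]\!]_\phi=[\![t]\!]_\phi\times[\![u]\!]_\phi$, $[\![\vec 0]\!]_\phi=\{\vec 0\}$, $[\![\Uparrow t]\!]_\phi=[\![t]\!]_\phi$, application applies (linear combinations of) functions to arguments (linearly over both when the function has type $S(\Psi\Rightarrow A)$), and measurement $\pi_j$ yields the set of all normalized post-measurement states. *)

theory Defs
  imports Complex_Main "HOL-Library.Function_Algebras"
begin

section \<open>Types\<close>

text \<open>One datatype for all types; the predicates below carve out the grammars of base qubit types,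
  qubit types and types. The typing rules only ever derive types satisfying \<open>wf_ty\<close>.\<close>

datatype ty = Qubit | Superpos ty | Tensor ty ty (infixr "\<otimes>\<^sub>T" 70) | Arrow ty ty (infixr "\<Rightarrow>\<^sub>T" 65)

primrec base_ty :: "ty \<Rightarrow> bool" where
  "base_ty Qubit = True"
| "base_ty (Superpos A) = False"
| "base_ty (A \<otimes>\<^sub>T B) = (base_ty A \<and> base_ty B)"
| "base_ty (A \<Rightarrow>\<^sub>T B) = False"

primrec qubit_ty :: "ty \<Rightarrow> bool" where
  "qubit_ty Qubit = True"
| "qubit_ty (Superpos A) = qubit_ty A"
| "qubit_ty (A \<otimes>\<^sub>T B) = (qubit_ty A \<and> qubit_ty B)"
| "qubit_ty (A \<Rightarrow>\<^sub>T B) = False"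

primrec wf_ty :: "ty \<Rightarrow> bool" where
  "wf_ty Qubit = True"
| "wf_ty (Superpos A) = wf_ty A"
| "wf_ty (A \<otimes>\<^sub>T B) = (wf_ty A \<and> wf_ty B)"
| "wf_ty (P \<Rightarrow>\<^sub>T A) = (qubit_ty P \<and> wf_ty A)"

text \<open>The \<open>n\<close>-fold tensor power of the qubit type; it is only used (and specified) for \<open>n \<ge> 1\<close>.\<close>

fun qubits :: "nat \<Rightarrow> ty" where
  "qubits (Suc 0) = Qubit"
| "qubits (Suc (Suc n)) = Qubit \<otimes>\<^sub>T qubits (Suc n)"

text \<open>Reflexivity and transitivity are not needed as rules: subsumption can be iterated.\<close>

inductive subty :: "ty \<Rightarrow> ty \<Rightarrow> bool" (infix "\<preceq>" 50) where
  sub_sup: "A \<preceq> Superpos A"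
| sub_idem: "Superpos (Superpos A) \<preceq> Superpos A"
| sub_fun: "A \<preceq> B \<Longrightarrow> P \<Rightarrow>\<^sub>T A \<preceq> P \<Rightarrow>\<^sub>T B"
| sub_cong: "A \<preceq> B \<Longrightarrow> Superpos A \<preceq> Superpos B"
| sub_left: "A \<preceq> B \<Longrightarrow> A \<otimes>\<^sub>T C \<preceq> B \<otimes>\<^sub>T C"
| sub_right: "A \<preceq> B \<Longrightarrow> C \<otimes>\<^sub>T A \<preceq> C \<otimes>\<^sub>T B"


section \<open>Terms and typing\<close>

type_synonym var = string

text \<open>\<open>Null A\<close> is the null vector of type \<open>Superpos A\<close>; \<open>Cond P\<close> is the if-then-else constant with
  branches of type \<open>P\<close>; \<open>Proj j t\<close> measures the first \<open>j\<close> qubits of \<open>t\<close>; \<open>Cast B C A t\<close> casts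
  \<open>t\<close> from type \<open>A\<close> to \<open>Superpos (B \<otimes>\<^sub>T C)\<close>.\<close>

datatype tm =
    Var var
  | Lam var ty tm
  | App tm tm
  | Ket0
  | Ket1
  | Plus tm tm
  | Scale complex tm
  | Null ty
  | Cond ty
  | Proj nat tm
  | Prod tm tm
  | Head tm
  | Tail tm
  | Cast ty ty ty tm

type_synonym ctx = "var \<rightharpoonup> ty"

text \<open>Contexts of the premises of a rule are disjoint, except that variables of base type may be
  shared. So contraction, which is only permitted on base types, is part of the composition
  \<open>\<Gamma> ++ \<Delta>\<close> of contexts.\<close>

definition composable :: "ctx \<Rightarrow> ctx \<Rightarrow> bool" where
  "composable \<Gamma> \<Delta> \<longleftrightarrow>
     (\<forall>x \<in> dom \<Gamma> \<inter> dom \<Delta>. \<exists>B. base_ty B \<and> \<Gamma> x = Some B \<and> \<Delta> x = Some B)"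

inductive typing :: "ctx \<Rightarrow> tm \<Rightarrow> ty \<Rightarrow> bool" ("_ \<turnstile> _ \<^bold>: _" [50, 50, 50] 50) where
  ty_var: "qubit_ty P \<Longrightarrow> [x \<mapsto> P] \<turnstile> Var x \<^bold>: P"
| ty_null: "wf_ty A \<Longrightarrow> Map.empty \<turnstile> Null A \<^bold>: Superpos A"
| ty_ket0: "Map.empty \<turnstile> Ket0 \<^bold>: Qubit"
| ty_ket1: "Map.empty \<turnstile> Ket1 \<^bold>: Qubit"
| ty_scale: "\<Gamma> \<turnstile> t \<^bold>: A \<Longrightarrow> \<Gamma> \<turnstile> Scale \<alpha> t \<^bold>: Superpos A"
| ty_plus: "\<Gamma> \<turnstile> t \<^bold>: A \<Longrightarrow> \<Delta> \<turnstile> u \<^bold>: A \<Longrightarrow> composable \<Gamma> \<Delta> \<Longrightarrow> \<Gamma> ++ \<Delta> \<turnstile> Plus t u \<^bold>: Superpos A"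
| ty_proj: "\<Gamma> \<turnstile> t \<^bold>: Superpos (qubits n) \<Longrightarrow> 0 < j \<Longrightarrow> j < n \<Longrightarrow>
    \<Gamma> \<turnstile> Proj j t \<^bold>: qubits j \<otimes>\<^sub>T Superpos (qubits (n - j))"
| ty_proj_all: "\<Gamma> \<turnstile> t \<^bold>: Superpos (qubits n) \<Longrightarrow> 0 < n \<Longrightarrow> \<Gamma> \<turnstile> Proj n t \<^bold>: qubits n"
| ty_sub: "\<Gamma> \<turnstile> t \<^bold>: A \<Longrightarrow> A \<preceq> B \<Longrightarrow> \<Gamma> \<turnstile> t \<^bold>: B"
| ty_cond: "qubit_ty P \<Longrightarrow> Map.empty \<turnstile> Cond P \<^bold>: Qubit \<Rightarrow>\<^sub>T P \<Rightarrow>\<^sub>T P \<Rightarrow>\<^sub>T P"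
| ty_lam: "\<Gamma>(x \<mapsto> P) \<turnstile> t \<^bold>: A \<Longrightarrow> x \<notin> dom \<Gamma> \<Longrightarrow> qubit_ty P \<Longrightarrow> \<Gamma> \<turnstile> Lam x P t \<^bold>: P \<Rightarrow>\<^sub>T A"
| ty_app: "\<Gamma> \<turnstile> t \<^bold>: P \<Rightarrow>\<^sub>T A \<Longrightarrow> \<Delta> \<turnstile> u \<^bold>: P \<Longrightarrow> composable \<Gamma> \<Delta> \<Longrightarrow> \<Gamma> ++ \<Delta> \<turnstile> App t u \<^bold>: A"
| ty_app_sup: "\<Gamma> \<turnstile> t \<^bold>: Superpos (P \<Rightarrow>\<^sub>T A) \<Longrightarrow> \<Delta> \<turnstile> u \<^bold>: Superpos P \<Longrightarrow> composable \<Gamma> \<Delta> \<Longrightarrow>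
    \<Gamma> ++ \<Delta> \<turnstile> App t u \<^bold>: Superpos A"
| ty_weak: "\<Gamma> \<turnstile> t \<^bold>: A \<Longrightarrow> x \<notin> dom \<Gamma> \<Longrightarrow> base_ty B \<Longrightarrow> \<Gamma>(x \<mapsto> B) \<turnstile> t \<^bold>: A"
| ty_pair: "\<Gamma> \<turnstile> t \<^bold>: A \<Longrightarrow> \<Delta> \<turnstile> u \<^bold>: B \<Longrightarrow> composable \<Gamma> \<Delta> \<Longrightarrow> \<Gamma> ++ \<Delta> \<turnstile> Prod t u \<^bold>: A \<otimes>\<^sub>T B"
| ty_head: "\<Gamma> \<turnstile> t \<^bold>: Qubit \<otimes>\<^sub>T B \<Longrightarrow> base_ty B \<Longrightarrow> \<Gamma> \<turnstile> Head t \<^bold>: Qubit"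
| ty_tail: "\<Gamma> \<turnstile> t \<^bold>: Qubit \<otimes>\<^sub>T B \<Longrightarrow> base_ty B \<Longrightarrow> \<Gamma> \<turnstile> Tail t \<^bold>: B"
| ty_cast_left: "A = (Superpos ^^ k) (Superpos B \<otimes>\<^sub>T C) \<Longrightarrow> \<Gamma> \<turnstile> t \<^bold>: A \<Longrightarrow>
    \<Gamma> \<turnstile> Cast B C A t \<^bold>: Superpos (B \<otimes>\<^sub>T C)"
| ty_cast_right: "A = (Superpos ^^ k) (B \<otimes>\<^sub>T Superpos C) \<Longrightarrow> \<Gamma> \<turnstile> t \<^bold>: A \<Longrightarrow>
    \<Gamma> \<turnstile> Cast B C A t \<^bold>: Superpos (B \<otimes>\<^sub>T C)"


section \<open>Vectors\<close>

text \<open>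
  All the vector spaces involved are spaces of complex coordinate families, realised inside the one
  type \<open>vec\<close>. Coordinates are indexed by words:
  \<^item> a vector of \<open>n\<close> qubits by the bit strings of length \<open>n\<close>;
  \<^item> a vector-valued function by the one-letter words \<open>[Arg a i]\<close>, holding coordinate \<open>i\<close> of the
    value at the argument \<open>a\<close>, so that linear operations on functions are pointwise;
  \<^item> a tensor by the concatenation of an index of each factor.
  Arguments are always qubit vectors, whose coordinates are given by bit strings alone; this is what
  makes the index type well-founded.
\<close>

type_synonym qvec = "bool list \<Rightarrow> complex"
datatype letter = Bit bool | Arg qvec "letter list"
type_synonym vec = "letter list \<Rightarrow> complex"

definition cscale :: "complex \<Rightarrow> vec \<Rightarrow> vec" (infixr "*\<^sub>V" 75) where
  "c *\<^sub>V v = (\<lambda>w. c * v w)"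

interpretation cvec: vector_space cscale
  by unfold_locales (auto simp: cscale_def fun_eq_iff algebra_simps)

definition ket :: "bool list \<Rightarrow> vec" where
  "ket bs = (\<lambda>w. if w = map Bit bs then 1 else 0)"

text \<open>The Kronecker product. The indices of a given space all have the same length, so at most the
  summand that splits \<open>w\<close> into an index for \<open>u\<close> and one for \<open>v\<close> is nonzero.\<close>

definition tensor :: "vec \<Rightarrow> vec \<Rightarrow> vec" (infixr "\<otimes>\<^sub>V" 70) where
  "u \<otimes>\<^sub>V v = (\<lambda>w. \<Sum>k\<le>length w. u (take k w) * v (drop k w))"

definition qcoords :: "vec \<Rightarrow> qvec" where
  "qcoords a = (\<lambda>bs. a (map Bit bs))"

definition apply_vec :: "vec \<Rightarrow> vec \<Rightarrow> vec" (infixl "\<cdot>" 72) where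
  "f \<cdot> a = (\<lambda>i. f [Arg (qcoords a) i])"

text \<open>Functions with domain \<open>D\<close> mapping each \<open>a\<close> into \<open>F a\<close>. All coordinates not belonging to an
  argument in \<open>D\<close> are zero, so a function is determined by its values on \<open>D\<close>.\<close>

definition funs :: "vec set \<Rightarrow> (vec \<Rightarrow> vec set) \<Rightarrow> vec set" where
  "funs D F = {f. (\<forall>w. f w \<noteq> 0 \<longrightarrow> (\<exists>a\<in>D. \<exists>i. w = [Arg (qcoords a) i])) \<and> (\<forall>a\<in>D. f \<cdot> a \<in> F a)}"

text \<open>The Euclidean norm of a vector with finitely many nonzero coordinates.\<close>

definition vnorm :: "vec \<Rightarrow> real" where
  "vnorm v = sqrt (\<Sum>w | v w \<noteq> 0. (cmod (v w))\<^sup>2)"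

text \<open>If measuring the first \<open>length bs\<close> qubits of \<open>v\<close> gives \<open>bs\<close>, the state of the remaining qubits
  is \<open>residue bs v\<close> up to normalisation. If no qubit remains, the residue is a scalar (its only
  nonzero coordinate is at \<open>[]\<close>); normalised, it is a global phase, which is dropped.\<close>

definition residue :: "bool list \<Rightarrow> vec \<Rightarrow> vec" where
  "residue bs v = (\<lambda>w. v (map Bit bs @ w))"

definition post_state :: "bool list \<Rightarrow> vec \<Rightarrow> vec" where
  "post_state bs v =
     (if \<forall>w. w \<noteq> [] \<longrightarrow> residue bs v w = 0 then ket bs
      else ket bs \<otimes>\<^sub>V (complex_of_real (1 / vnorm (residue bs v)) *\<^sub>V residue bs v))"


section \<open>Interpretation\<close>

primrec ty_sem :: "ty \<Rightarrow> vec set" where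
  "ty_sem Qubit = {ket [False], ket [True]}"
| "ty_sem (Superpos A) = cvec.span (ty_sem A)"
| "ty_sem (A \<otimes>\<^sub>T B) = {u \<otimes>\<^sub>V v | u v. u \<in> ty_sem A \<and> v \<in> ty_sem B}"
| "ty_sem (P \<Rightarrow>\<^sub>T A) = funs (ty_sem P) (\<lambda>_. ty_sem A)"

type_synonym valuation = "var \<Rightarrow> vec"

definition is_valuation :: "ctx \<Rightarrow> valuation \<Rightarrow> bool" where
  "is_valuation \<Gamma> \<phi> \<longleftrightarrow> (\<forall>x P. \<Gamma> x = Some P \<longrightarrow> \<phi> x \<in> ty_sem P)"

text \<open>A subterm uses only part of the (linear) context of the whole term.\<close>

definition has_type :: "ctx \<Rightarrow> tm \<Rightarrow> ty \<Rightarrow> bool" where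
  "has_type \<Gamma> t A \<longleftrightarrow> (\<exists>\<Delta>. \<Delta> \<subseteq>\<^sub>m \<Gamma> \<and> \<Delta> \<turnstile> t \<^bold>: A)"

text \<open>The context is a parameter because the meaning of an application depends on the types of
  its subterms. By subsumption, a term of type \<open>P \<Rightarrow>\<^sub>T A\<close> also has type \<open>Superpos (P \<Rightarrow>\<^sub>T A)\<close>; plain
  application takes precedence whenever it is well-typed. In the clauses for \<open>Head\<close> and \<open>Tail\<close>,
  requiring \<open>a\<close> to be a basis vector makes the factorisation unique.\<close>

primrec tm_sem :: "ctx \<Rightarrow> tm \<Rightarrow> valuation \<Rightarrow> vec set" where
  "tm_sem \<Gamma> (Var x) \<phi> = {\<phi> x}"
| "tm_sem \<Gamma> (Lam x P t) \<phi> = funs (ty_sem P) (\<lambda>a. tm_sem (\<Gamma>(x \<mapsto> P)) t (\<phi>(x := a)))"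
| "tm_sem \<Gamma> (App t u) \<phi> =
     (if \<exists>P A. has_type \<Gamma> t (P \<Rightarrow>\<^sub>T A) \<and> has_type \<Gamma> u P
      then {f \<cdot> a | f a. f \<in> tm_sem \<Gamma> t \<phi> \<and> a \<in> tm_sem \<Gamma> u \<phi>}
      else {\<Sum>i<m. \<Sum>j<n. (\<alpha> i * \<beta> j) *\<^sub>V (g i \<cdot> b j) | (m::nat) (n::nat) \<alpha> \<beta> g b.
        \<exists>P A. has_type \<Gamma> t (Superpos (P \<Rightarrow>\<^sub>T A)) \<and> has_type \<Gamma> u (Superpos P) \<and>
          (\<forall>i<m. g i \<in> ty_sem (P \<Rightarrow>\<^sub>T A)) \<and> (\<Sum>i<m. \<alpha> i *\<^sub>V g i) \<in> tm_sem \<Gamma> t \<phi> \<and>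
          (\<forall>j<n. b j \<in> ty_sem P) \<and> (\<Sum>j<n. \<beta> j *\<^sub>V b j) \<in> tm_sem \<Gamma> u \<phi>})"
| "tm_sem \<Gamma> Ket0 \<phi> = {ket [False]}"
| "tm_sem \<Gamma> Ket1 \<phi> = {ket [True]}"
| "tm_sem \<Gamma> (Plus t u) \<phi> = {a + b | a b. a \<in> tm_sem \<Gamma> t \<phi> \<and> b \<in> tm_sem \<Gamma> u \<phi>}"
| "tm_sem \<Gamma> (Scale \<alpha> t) \<phi> = {\<alpha> *\<^sub>V a | a. a \<in> tm_sem \<Gamma> t \<phi>}"
| "tm_sem \<Gamma> (Null A) \<phi> = {0}"
| "tm_sem \<Gamma> (Cond P) \<phi> =
     funs (ty_sem Qubit) (\<lambda>a. funs (ty_sem P) (\<lambda>b. funs (ty_sem P) (\<lambda>c.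
       {if a = ket [True] then b else c})))"
| "tm_sem \<Gamma> (Proj j t) \<phi> =
     {post_state bs v | bs v. v \<in> tm_sem \<Gamma> t \<phi> \<and> length bs = j \<and> residue bs v \<noteq> 0}"
| "tm_sem \<Gamma> (Prod t u) \<phi> = {a \<otimes>\<^sub>V b | a b. a \<in> tm_sem \<Gamma> t \<phi> \<and> b \<in> tm_sem \<Gamma> u \<phi>}"
| "tm_sem \<Gamma> (Head t) \<phi> = {a | a b. a \<in> ty_sem Qubit \<and> a \<otimes>\<^sub>V b \<in> tm_sem \<Gamma> t \<phi>}"
| "tm_sem \<Gamma> (Tail t) \<phi> = {b | a b. a \<in> ty_sem Qubit \<and> a \<otimes>\<^sub>V b \<in> tm_sem \<Gamma> t \<phi>}"
| "tm_sem \<Gamma> (Cast B C A t) \<phi> = tm_sem \<Gamma> t \<phi>"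

end

theory Submission
  imports Defs
begin

text \<open>Induction on the typing derivation, for all contexts extending the derived one. The meaning of
  an application depends on which typings of its subterms exist, not on the given derivation. This
  does no harm: an element \<open>f\<close> of the span of \<open>P \<Rightarrow>\<^sub>T A\<close> vanishes off \<open>P\<close>, so it sends \<^emph>\<open>every\<close>
  argument into the span of \<open>A\<close>, whatever decomposition of function and argument was chosen.\<close>

section \<open>Tensor products\<close>

text \<open>Since \<open>ket bs\<close> vanishes off words of length \<open>length bs\<close>, only
  the cut of \<open>w\<close> at that position contributes to the sum. If \<open>w\<close> is too
  short, no cut does, and the test on the prefix fails as well.\<close>

lemma tensor_ket_left:
  "ket bs \<otimes>\<^sub>V v = (\<lambda>w. if take (length bs) w = map Bit bs then v (drop (length bs) w) else 0)"
proof
  fix w :: "letter list"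
  have eq: "ket bs (take k w) * v (drop k w) =
      (if k = length bs then (if take (length bs) w = map Bit bs then v (drop (length bs) w) else 0) else 0)"
    if "k \<le> length w" for k
    using that by (auto simp: ket_def dest: arg_cong[where f = length])
  show "(ket bs \<otimes>\<^sub>V v) w = (if take (length bs) w = map Bit bs then v (drop (length bs) w) else 0)"
    unfolding tensor_def
    by (subst sum.cong[OF refl eq]) (auto dest: arg_cong[where f = length])
qed

lemma inj_map_Bit: "inj (map Bit)"
  by (simp add: inj_def inj_map_eq_map)

lemma tensor_ket_ket: "ket bs \<otimes>\<^sub>V ket cs = ket (bs @ cs)"
  unfolding tensor_ket_left
  by (auto simp: ket_def fun_eq_iff) (metis append_take_drop_id)

lemma ket_nonzero: "ket bs \<noteq> 0"
  by (auto simp: ket_def fun_eq_iff)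

text \<open>Evaluating at the words \<open>Bit z # w\<close> reads off the factors: a nonzero
  coordinate of \<open>v\<close> forces the leading bits to agree, and then the tails agree
  pointwise. This identifies the factorisations that arise for \<open>Tail\<close>.\<close>

lemma tensor_ket_cancel:
  assumes eq: "ket [x] \<otimes>\<^sub>V u = ket [y] \<otimes>\<^sub>V v" and "v \<noteq> 0"
  shows "u = v"
proof -
  have ev: "(if z = x then u w else 0) = (if z = y then v w else 0)" for z w
    using fun_cong[OF eq, of "Bit z # w"] by (auto simp: tensor_ket_left split: if_splits)
  from \<open>v \<noteq> 0\<close> obtain w where "v w \<noteq> 0"
    by (auto simp: fun_eq_iff)
  with ev[of y w] have "x = y"
    by (auto split: if_splits)
  with ev[of y] show ?thesis
    by auto
qed

lemma tensor_add_left: "(u + u') \<otimes>\<^sub>V v = u \<otimes>\<^sub>V v + u' \<otimes>\<^sub>V v"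
  by (simp add: tensor_def fun_eq_iff algebra_simps sum.distrib)

lemma tensor_add_right: "u \<otimes>\<^sub>V (v + v') = u \<otimes>\<^sub>V v + u \<otimes>\<^sub>V v'"
  by (simp add: tensor_def fun_eq_iff algebra_simps sum.distrib)

lemma tensor_scale_left: "(c *\<^sub>V u) \<otimes>\<^sub>V v = c *\<^sub>V (u \<otimes>\<^sub>V v)"
  by (simp add: tensor_def cscale_def fun_eq_iff sum_distrib_left mult.assoc)

lemma tensor_scale_right: "u \<otimes>\<^sub>V (c *\<^sub>V v) = c *\<^sub>V (u \<otimes>\<^sub>V v)"
  by (simp add: tensor_def cscale_def fun_eq_iff sum_distrib_left algebra_simps)

lemma tensor_zero_left: "0 \<otimes>\<^sub>V v = 0"
  by (simp add: tensor_def fun_eq_iff)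

lemma tensor_zero_right: "u \<otimes>\<^sub>V 0 = 0"
  by (simp add: tensor_def fun_eq_iff)

text \<open>For fixed \<open>v\<close> the product is linear in \<open>u\<close>, so the
  \<open>u\<close> whose product lands in the span form a subspace. This and its mirror image
  justify the casts.\<close>

lemma tensor_span_left: "{u \<otimes>\<^sub>V v | u v. u \<in> cvec.span U \<and> v \<in> V} \<subseteq> cvec.span {u \<otimes>\<^sub>V v | u v. u \<in> U \<and> v \<in> V}"
proof clarify
  fix u v
  assume "u \<in> cvec.span U" "v \<in> V"
  show "u \<otimes>\<^sub>V v \<in> cvec.span {u \<otimes>\<^sub>V v | u v. u \<in> U \<and> v \<in> V}"
    using \<open>u \<in> cvec.span U\<close>
  proof (rule cvec.span_induct)
    show "cvec.subspace {u. u \<otimes>\<^sub>V v \<in> cvec.span {u \<otimes>\<^sub>V v | u v. u \<in> U \<and> v \<in> V}}"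
      by (simp add: cvec.subspace_def tensor_add_left tensor_scale_left tensor_zero_left
          cvec.span_zero cvec.span_add cvec.span_scale)
    show "u \<otimes>\<^sub>V v \<in> cvec.span {u \<otimes>\<^sub>V v | u v. u \<in> U \<and> v \<in> V}" if "u \<in> U" for u
      using that \<open>v \<in> V\<close> by (auto intro: cvec.span_base)
  qed
qed

lemma tensor_span_right: "{u \<otimes>\<^sub>V v | u v. u \<in> U \<and> v \<in> cvec.span V} \<subseteq> cvec.span {u \<otimes>\<^sub>V v | u v. u \<in> U \<and> v \<in> V}"
proof clarify
  fix u v
  assume "u \<in> U" "v \<in> cvec.span V"
  show "u \<otimes>\<^sub>V v \<in> cvec.span {u \<otimes>\<^sub>V v | u v. u \<in> U \<and> v \<in> V}"
    using \<open>v \<in> cvec.span V\<close>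
  proof (rule cvec.span_induct)
    show "cvec.subspace {v. u \<otimes>\<^sub>V v \<in> cvec.span {u \<otimes>\<^sub>V v | u v. u \<in> U \<and> v \<in> V}}"
      by (simp add: cvec.subspace_def tensor_add_right tensor_scale_right tensor_zero_right
          cvec.span_zero cvec.span_add cvec.span_scale)
    show "u \<otimes>\<^sub>V v \<in> cvec.span {u \<otimes>\<^sub>V v | u v. u \<in> U \<and> v \<in> V}" if "v \<in> V" for v
      using that \<open>u \<in> U\<close> by (auto intro: cvec.span_base)
  qed
qed


section \<open>Functions\<close>

lemma funs_mono: "(\<And>a. a \<in> D \<Longrightarrow> F a \<subseteq> G a) \<Longrightarrow> funs D F \<subseteq> funs D G"
  by (auto simp: funs_def)

lemma apply_vec_add: "(f + g) \<cdot> a = f \<cdot> a + g \<cdot> a"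
  by (simp add: apply_vec_def fun_eq_iff)

lemma apply_vec_scale: "(c *\<^sub>V f) \<cdot> a = c *\<^sub>V (f \<cdot> a)"
  by (simp add: apply_vec_def cscale_def)

lemma apply_vec_zero: "0 \<cdot> a = 0"
  by (simp add: apply_vec_def fun_eq_iff)

lemma sum_vec_apply: "(\<Sum>i\<in>I. g i :: vec) w = (\<Sum>i\<in>I. g i w)"
  by (induction I rule: infinite_finite_induct) simp_all

lemma apply_vec_sum: "(\<Sum>i\<in>I. g i) \<cdot> a = (\<Sum>i\<in>I. g i \<cdot> a)"
  by (simp add: apply_vec_def fun_eq_iff sum_vec_apply)

lemma apply_vec_span:
  assumes "f \<in> cvec.span (funs D (\<lambda>_. V))"
  shows "f \<cdot> a \<in> cvec.span V"
  using assms
proof (rule cvec.span_induct)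
  show "cvec.subspace {f. f \<cdot> a \<in> cvec.span V}"
    by (auto intro!: cvec.subspaceI cvec.span_zero cvec.span_add cvec.span_scale
        simp: apply_vec_add apply_vec_scale apply_vec_zero)
next
  fix f assume f: "f \<in> funs D (\<lambda>_. V)"
  show "f \<cdot> a \<in> cvec.span V"
  \<comment> \<open>Application sees only \<open>qcoords a\<close>, so an argument outside
    \<open>D\<close> may still act like one inside; otherwise all coordinates read from
    \<open>f\<close> are zero.\<close>
  proof (cases "\<exists>b\<in>D. qcoords a = qcoords b")
    case True
    then obtain b where "b \<in> D" "f \<cdot> a = f \<cdot> b"
      by (auto simp: apply_vec_def)
    with f show ?thesis
      by (auto simp: funs_def intro: cvec.span_base)
  next
    case False
    with f have "f \<cdot> a = 0"
      by (fastforce simp: funs_def apply_vec_def fun_eq_iff)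
    then show ?thesis
      by (simp add: cvec.span_zero)
  qed
qed

text \<open>For each fixed \<open>b j\<close>, collecting the terms over \<open>i\<close> rebuilds
  the whole function. The double sum is thus a combination of values of one function in the
  span.\<close>

lemma double_sum_apply_in_span:
  fixes m n :: nat
  assumes "(\<Sum>i<m. \<alpha> i *\<^sub>V g i) \<in> cvec.span (funs D (\<lambda>_. V))"
  shows "(\<Sum>i<m. \<Sum>j<n. (\<alpha> i * \<beta> j) *\<^sub>V (g i \<cdot> b j)) \<in> cvec.span V"
proof -
  have "(\<Sum>i<m. \<Sum>j<n. (\<alpha> i * \<beta> j) *\<^sub>V (g i \<cdot> b j)) =
      (\<Sum>j<n. \<Sum>i<m. \<beta> j *\<^sub>V ((\<alpha> i *\<^sub>V g i) \<cdot> b j))"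
    by (subst sum.swap) (simp add: apply_vec_scale mult.commute)
  also have "\<dots> = (\<Sum>j<n. \<beta> j *\<^sub>V ((\<Sum>i<m. \<alpha> i *\<^sub>V g i) \<cdot> b j))"
    by (simp add: apply_vec_sum cvec.scale_sum_right)
  also have "\<dots> \<in> cvec.span V"
    by (intro cvec.span_sum cvec.span_scale apply_vec_span[OF assms])
  finally show ?thesis .
qed


section \<open>Types\<close>

lemma subty_sound: "A \<preceq> B \<Longrightarrow> ty_sem A \<subseteq> ty_sem B"
proof (induction rule: subty.induct)
  case (sub_sup A)
  then show ?case by (simp add: cvec.span_superset)
next
  case (sub_fun A B P)
  then show ?case by (simp add: funs_mono)
next
  case (sub_cong A B)
  then show ?case by (simp add: cvec.span_mono)
qed (auto simp: cvec.span_span)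

text \<open>A tensor of kets is the ket of the concatenated words. This serves to exclude the zero
  vector from base types.\<close>

lemma base_ty_sem: "base_ty B \<Longrightarrow> ty_sem B \<subseteq> range ket"
proof (induction B)
  case (Tensor A B)
  then show ?case
    by (auto simp: subset_iff image_iff) (metis tensor_ket_ket)
qed auto

lemma ty_sem_Qubit: "ty_sem Qubit = range (\<lambda>b. ket [b])"
  by (simp add: UNIV_bool)

lemma ty_sem_qubits: "0 < n \<Longrightarrow> ty_sem (qubits n) = {ket bs | bs. length bs = n}"
proof (induction n rule: qubits.induct)
  case 1
  show ?case
    unfolding qubits.simps ty_sem_Qubit by (auto simp: length_Suc_conv)
next
  case (2 n)
  then have IH: "ty_sem (qubits (Suc n)) = {ket bs | bs. length bs = Suc n}"
    by simp
  have "ty_sem (qubits (Suc (Suc n))) = {ket [b] \<otimes>\<^sub>V ket bs | b bs. length bs = Suc n}"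
    unfolding qubits.simps ty_sem.simps(3) ty_sem_Qubit IH by blast
  also have "\<dots> = {ket bs | bs. length bs = Suc (Suc n)}"
    by (simp add: tensor_ket_ket length_Suc_conv[of _ "Suc n"]) blast
  finally show ?case .
\<comment> \<open>What remains is \<open>n = 0\<close>, where \<open>qubits\<close> is unspecified;
  the premise excludes it.\<close>
qed auto

text \<open>A cast may start from any number of outer \<open>Superpos\<close> layers, including
  none; a span is a subspace, so further spans inside it do not leave it.\<close>

lemma ty_sem_superpos_pow:
  assumes "ty_sem X \<subseteq> cvec.span V"
  shows "ty_sem ((Superpos ^^ k) X) \<subseteq> cvec.span V"
  using assms
  by (induction k) (simp_all add: cvec.span_minimal)


section \<open>Measurement\<close>

text \<open>The residue is linear in \<open>v\<close>. On a basis ket it either strips the prefix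
  \<open>bs\<close> or, if the prefix differs, gives zero.\<close>

lemma residue_span:
  assumes "v \<in> cvec.span {ket cs | cs. length cs = n}" and "length bs = j"
  shows "residue bs v \<in> cvec.span {ket cs | cs. length cs = n - j}"
  using assms(1)
proof (rule cvec.span_induct)
  have "residue bs 0 = 0" "residue bs (u + v) = residue bs u + residue bs v"
    "residue bs (c *\<^sub>V v) = c *\<^sub>V residue bs v" for u v c
    by (simp_all add: residue_def cscale_def fun_eq_iff)
  then show "cvec.subspace {v. residue bs v \<in> cvec.span {ket cs | cs. length cs = n - j}}"
    by (auto intro!: cvec.subspaceI cvec.span_zero cvec.span_add cvec.span_scale)
next
  fix v assume "v \<in> {ket cs | cs. length cs = n}"
  then obtain cs where v: "v = ket cs" and cs: "length cs = n"
    by blast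
  show "residue bs v \<in> cvec.span {ket cs | cs. length cs = n - j}"
  proof (cases "\<exists>ds. cs = bs @ ds")
    case True
    then obtain ds where "cs = bs @ ds"
      by blast
    then have "residue bs v = ket ds" "length ds = n - j"
      using cs assms(2) by (auto simp: v residue_def ket_def fun_eq_iff)
    then show ?thesis
      by (auto intro: cvec.span_base)
  next
    case False
    \<comment> \<open>A prefix match between words of letters comes from one between bit strings,
      because \<open>Bit\<close> is injective.\<close>
    have "map Bit bs @ w \<noteq> map Bit cs" for w
    proof
      assume "map Bit bs @ w = map Bit cs"
      then obtain us vs where "cs = us @ vs" "map Bit bs = map Bit us"
        by (metis append_eq_map_conv)
      with False inj_map_Bit show False
        by (auto dest: injD)
    qed
    then have "residue bs v = 0"
      by (auto simp: v residue_def ket_def fun_eq_iff)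
    then show ?thesis
      by (simp add: cvec.span_zero)
  qed
qed

lemma span_ket_support:
  assumes "v \<in> cvec.span {ket cs | cs. length cs = n}" and "length w \<noteq> n"
  shows "v w = 0"
  using assms(1)
  by (rule cvec.span_induct)
    (use assms(2) in \<open>auto intro!: cvec.subspaceI simp: cscale_def ket_def\<close>)

text \<open>With at least one qubit left, the residue has no coordinate at \<open>[]\<close>. Being
  nonzero, it has one at a nonempty word, which selects the second branch of
  \<open>post_state\<close>; normalising is a scaling and stays in the span.\<close>

lemma post_state_proper:
  assumes "v \<in> cvec.span {ket cs | cs. length cs = n}" and "length bs < n" and "residue bs v \<noteq> 0"
  obtains u where "u \<in> cvec.span {ket cs | cs. length cs = n - length bs}"
    and "post_state bs v = ket bs \<otimes>\<^sub>V u"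
proof
  note res = residue_span[OF assms(1) refl, of bs]
  show "complex_of_real (1 / vnorm (residue bs v)) *\<^sub>V residue bs v
      \<in> cvec.span {ket cs | cs. length cs = n - length bs}"
    by (intro cvec.span_scale res)
  have "residue bs v [] = 0"
    using span_ket_support[OF res] assms(2) by simp
  then have "\<not> (\<forall>w. w \<noteq> [] \<longrightarrow> residue bs v w = 0)"
    using assms(3) by (metis ext zero_fun_apply)
  then show "post_state bs v = ket bs \<otimes>\<^sub>V (complex_of_real (1 / vnorm (residue bs v)) *\<^sub>V residue bs v)"
    unfolding post_state_def by (rule if_not_P)
qed

text \<open>With no qubit left, the residue is supported on \<open>[]\<close> alone, so the first
  branch applies and drops the phase.\<close>

lemma post_state_total:
  assumes "v \<in> cvec.span {ket cs | cs. length cs = n}" and "length bs = n"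
  shows "post_state bs v = ket bs"
  using span_ket_support[OF residue_span[OF assms]] by (simp add: post_state_def)


section \<open>Soundness\<close>

lemma is_valuation_update:
  "is_valuation \<Gamma> \<phi> \<Longrightarrow> a \<in> ty_sem P \<Longrightarrow> is_valuation (\<Gamma>(x \<mapsto> P)) (\<phi>(x := a))"
  by (auto simp: is_valuation_def)

text \<open>\<open>++\<close> prefers its right argument; the left context survives because shared
  variables carry the same type in both.\<close>

lemma composable_map_le_left:
  assumes "composable \<Gamma> \<Delta>" and "\<Gamma> ++ \<Delta> \<subseteq>\<^sub>m \<Theta>"
  shows "\<Gamma> \<subseteq>\<^sub>m \<Theta>"
  unfolding map_le_def
proof
  fix x assume x: "x \<in> dom \<Gamma>"
  then have "(\<Gamma> ++ \<Delta>) x = \<Gamma> x"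
    using assms(1) by (cases "x \<in> dom \<Delta>") (force simp: composable_def map_add_def split: option.splits)+
  moreover have "(\<Gamma> ++ \<Delta>) x = \<Theta> x"
    using assms(2) x by (simp add: map_le_def)
  ultimately show "\<Gamma> x = \<Theta> x"
    by simp
qed

lemma composable_map_le_right: "\<Gamma> ++ \<Delta> \<subseteq>\<^sub>m \<Theta> \<Longrightarrow> \<Delta> \<subseteq>\<^sub>m \<Theta>"
  using map_le_map_add map_le_trans by blast

lemma map_le_updD: "\<Gamma>(x \<mapsto> B) \<subseteq>\<^sub>m \<Theta> \<Longrightarrow> x \<notin> dom \<Gamma> \<Longrightarrow> \<Gamma> \<subseteq>\<^sub>m \<Theta>"
  by (auto simp: map_le_def dom_def split: if_splits)

text \<open>The context is generalised because \<open>tm_sem\<close> hands all of \<Gamma> to every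
  subterm, while the typing rules split it.\<close>

lemma typing_sound:
  assumes "\<Delta> \<turnstile> t \<^bold>: A" and "\<Delta> \<subseteq>\<^sub>m \<Gamma>" and "is_valuation \<Gamma> \<phi>"
  shows "tm_sem \<Gamma> t \<phi> \<subseteq> ty_sem A"
  using assms
proof (induction arbitrary: \<Gamma> \<phi> rule: typing.induct)
  case (ty_var P x)
  then have "\<Gamma> x = Some P"
    by (auto simp: map_le_def dom_def)
  with ty_var show ?case
    by (simp add: is_valuation_def)
next
  case (ty_null A)
  then show ?case
    by (simp add: cvec.span_zero)
next
  case (ty_scale \<Delta> t A \<alpha>)
  from ty_scale.IH[OF ty_scale.prems] show ?case
    by (auto intro: cvec.span_scale cvec.span_base)
next
  case (ty_plus \<Delta>1 t A \<Delta>2 u)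
  note le = composable_map_le_left[OF ty_plus.hyps(3) ty_plus.prems(1)]
    composable_map_le_right[OF ty_plus.prems(1)]
  from ty_plus.IH(1)[OF le(1) ty_plus.prems(2)] ty_plus.IH(2)[OF le(2) ty_plus.prems(2)]
  show ?case
    by (auto intro: cvec.span_add cvec.span_base)
next
  case (ty_proj \<Delta> t n j)
  then have sem: "tm_sem \<Gamma> t \<phi> \<subseteq> cvec.span {ket bs | bs. length bs = n}"
    by (simp add: ty_sem_qubits)
  show ?case
  proof
    fix p assume "p \<in> tm_sem \<Gamma> (Proj j t) \<phi>"
    then obtain bs v where p: "p = post_state bs v" and v: "v \<in> tm_sem \<Gamma> t \<phi>"
      and bs: "length bs = j" "residue bs v \<noteq> 0"
      by auto
    obtain u where "u \<in> cvec.span {ket cs | cs. length cs = n - length bs}" "p = ket bs \<otimes>\<^sub>V u"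
      using post_state_proper[of v n bs] sem v bs ty_proj.hyps p by blast
    then show "p \<in> ty_sem (qubits j \<otimes>\<^sub>T Superpos (qubits (n - j)))"
      using bs ty_proj.hyps by (auto simp: ty_sem_qubits)
  qed
next
  case (ty_proj_all \<Delta> t n)
  then have sem: "tm_sem \<Gamma> t \<phi> \<subseteq> cvec.span {ket bs | bs. length bs = n}"
    by (simp add: ty_sem_qubits)
  show ?case
  proof
    fix p assume "p \<in> tm_sem \<Gamma> (Proj n t) \<phi>"
    then obtain bs v where "p = post_state bs v" "v \<in> tm_sem \<Gamma> t \<phi>" "length bs = n"
      by auto
    then have "p = ket bs" "length bs = n"
      using sem post_state_total by blast+
    then show "p \<in> ty_sem (qubits n)"
      using ty_proj_all.hyps by (auto simp: ty_sem_qubits)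
  qed
next
  case (ty_sub \<Delta> t A B)
  then show ?case
    using subty_sound by blast
next
  case (ty_cond P)
  show ?case
    unfolding tm_sem.simps ty_sem.simps by (intro funs_mono) auto
next
  case (ty_lam \<Delta> x P t A)
  \<comment> \<open>\<Gamma> may already bind \<open>x\<close>; the update overwrites that binding,
    as it does in the valuation.\<close>
  have "\<Delta>(x \<mapsto> P) \<subseteq>\<^sub>m \<Gamma>(x \<mapsto> P)"
    using ty_lam.prems(1) by (rule map_le_upd)
  with ty_lam.IH ty_lam.prems(2) show ?case
    unfolding tm_sem.simps ty_sem.simps by (intro funs_mono) (blast intro: is_valuation_update)
next
  case (ty_app \<Delta>1 t P A \<Delta>2 u)
  note le = composable_map_le_left[OF ty_app.hyps(3) ty_app.prems(1)]
    composable_map_le_right[OF ty_app.prems(1)]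
  \<comment> \<open>The premises themselves witness the test in \<open>tm_sem\<close>, so the plain
    branch is taken.\<close>
  have "has_type \<Gamma> t (P \<Rightarrow>\<^sub>T A)" "has_type \<Gamma> u P"
    using le ty_app.hyps by (auto simp: has_type_def)
  then have plain: "\<exists>P A. has_type \<Gamma> t (P \<Rightarrow>\<^sub>T A) \<and> has_type \<Gamma> u P"
    by blast
  from ty_app.IH(1)[OF le(1) ty_app.prems(2)] ty_app.IH(2)[OF le(2) ty_app.prems(2)]
  show ?case
    unfolding tm_sem.simps if_P[OF plain] by (auto simp: funs_def)
next
  case (ty_app_sup \<Delta>1 t P A \<Delta>2 u)
  note le = composable_map_le_left[OF ty_app_sup.hyps(3) ty_app_sup.prems(1)]
  have sem: "f \<in> cvec.span (funs (ty_sem P) (\<lambda>_. ty_sem A))" if "f \<in> tm_sem \<Gamma> t \<phi>" for f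
    using ty_app_sup.IH(1)[OF le ty_app_sup.prems(2)] that by auto
  show ?case
  \<comment> \<open>This rule does not determine the branch: other typings of \<open>t\<close> and
    \<open>u\<close> may permit plain application. In both branches the function lies in the span of
    \<open>P \<Rightarrow>\<^sub>T A\<close> for the types of this rule.\<close>
  proof (cases "\<exists>P A. has_type \<Gamma> t (P \<Rightarrow>\<^sub>T A) \<and> has_type \<Gamma> u P")
    case True
    show ?thesis
      unfolding tm_sem.simps if_P[OF True] ty_sem.simps by (auto intro: apply_vec_span sem)
  next
    case False
    show ?thesis
      unfolding tm_sem.simps if_not_P[OF False] ty_sem.simps
      \<comment> \<open>The summands may come from a decomposition at other types; the induction
        hypothesis is applied to their total.\<close>
      by clarify (rule double_sum_apply_in_span[OF sem])
  qed
next
  case (ty_weak \<Delta> t A x B)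
  show ?case
    by (rule ty_weak.IH[OF map_le_updD[OF ty_weak.prems(1) ty_weak.hyps(2)] ty_weak.prems(2)])
next
  case (ty_pair \<Delta>1 t A \<Delta>2 u B)
  note le = composable_map_le_left[OF ty_pair.hyps(3) ty_pair.prems(1)]
    composable_map_le_right[OF ty_pair.prems(1)]
  from ty_pair.IH(1)[OF le(1) ty_pair.prems(2)] ty_pair.IH(2)[OF le(2) ty_pair.prems(2)]
  show ?case
    by auto
next
  case (ty_tail \<Delta> t B)
  show ?case
  proof
    fix b assume "b \<in> tm_sem \<Gamma> (Tail t) \<phi>"
    then obtain x where "ket [x] \<otimes>\<^sub>V b \<in> tm_sem \<Gamma> t \<phi>"
      by auto
    then have "ket [x] \<otimes>\<^sub>V b \<in> ty_sem (Qubit \<otimes>\<^sub>T B)"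
      using ty_tail by blast
    \<comment> \<open>There are now two factorisations, one from the meaning of \<open>Tail\<close>
      and one from the type; only the second is known to have its tail in \<open>B\<close>.\<close>
    then obtain y v where eq: "ket [x] \<otimes>\<^sub>V b = ket [y] \<otimes>\<^sub>V v" and v: "v \<in> ty_sem B"
      by auto
    have "v \<noteq> 0"
      using v base_ty_sem[OF ty_tail.hyps(2)] by (auto simp: ket_nonzero)
    with tensor_ket_cancel[OF eq] v show "b \<in> ty_sem B"
      by simp
  qed
next
  case (ty_cast_left A k B C \<Delta> t)
  have "ty_sem A \<subseteq> ty_sem (Superpos (B \<otimes>\<^sub>T C))"
    unfolding ty_cast_left.hyps(1) ty_sem.simps(2,3)
    by (rule ty_sem_superpos_pow) (simp add: tensor_span_left)
  with ty_cast_left show ?case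
    by auto
next
  case (ty_cast_right A k B C \<Delta> t)
  have "ty_sem A \<subseteq> ty_sem (Superpos (B \<otimes>\<^sub>T C))"
    unfolding ty_cast_right.hyps(1) ty_sem.simps(2,3)
    by (rule ty_sem_superpos_pow) (simp add: tensor_span_right)
  with ty_cast_right show ?case
    by auto
\<comment> \<open>The remaining cases are the two kets and \<open>Head\<close>, whose meaning is
  confined to \<open>ty_sem Qubit\<close> by definition.\<close>
qed auto

theorem theorem2:
  fixes \<Gamma> :: ctx and t :: tm and A :: ty and \<phi> :: valuation
  assumes "\<Gamma> \<turnstile> t \<^bold>: A"
    and "is_valuation \<Gamma> \<phi>"
  shows "tm_sem \<Gamma> t \<phi> \<subseteq> ty_sem A"
  using assms by (intro typing_sound) auto

end
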